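(* Let $N\ge1$ be an integer, let $a:[0,1]\to[0,+\infty)$ be continuous and not identically zero on any subinterval of $[0,1]$, and let $f:[0,+\infty)\to[0,+\infty)$ be continuous with $f(s)>0$ for $s>0$. Assume that there exists a positive constant $\varrho>0$ such that $\left|\frac{f(s)}{s^N}\right|\le\varrho$ for any $s>0$. Then there exists $\eta_*>0$ such that the problem $$\left((u')^N\right)'=\lambda^NNr^{N-1}a(r)f(-u),\ r\in(0,1),\qquad u'(0)=u(1)=0,$$ has no convex solution for any $\lambda\in(0,\eta_* )$.
   Context: A solution is a function $u\in C^2[0,1]$ satisfying the problem; a convex solution means a nontrivial ($u\not\equiv0$) convex solution, i.e. one that is negative and strictly convex in $(0,1)$. *)

theory Defs
  imports "HOL-Analysis.Analysis"
begin

text \<open>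
  \<open>u\<close> belongs to \<open>C\<^sup>2[0,1]\<close>, with first and second derivatives \<open>u'\<close> and \<open>u''\<close>.  Taking
  derivatives within \<open>{0..1}\<close> makes them one-sided at the end points, so values of \<open>u\<close>
  outside \<open>[0,1]\<close> play no role.
\<close>

definition C2_unit_interval :: "(real \<Rightarrow> real) \<Rightarrow> (real \<Rightarrow> real) \<Rightarrow> (real \<Rightarrow> real) \<Rightarrow> bool" where
  "C2_unit_interval u u' u'' \<longleftrightarrow>
     (\<forall>r\<in>{0..1}. (u has_real_derivative u' r) (at r within {0..1})) \<and>
     (\<forall>r\<in>{0..1}. (u' has_real_derivative u'' r) (at r within {0..1})) \<and>
     continuous_on {0..1} u''"

text \<open>
  As \<open>f\<close> lives on \<open>[0,\<infinity>)\<close>, the term \<open>f(-u)\<close> only makes sense where \<open>u \<le> 0\<close>; since \<open>f\<close> is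
  represented by a total function, this is recorded explicitly.  It does not restrict the
  convex solutions below: convexity with \<open>u'(0) = u(1) = 0\<close> already forces \<open>u \<le> 0\<close>.
\<close>

definition is_solution ::
  "nat \<Rightarrow> (real \<Rightarrow> real) \<Rightarrow> (real \<Rightarrow> real) \<Rightarrow> real \<Rightarrow> (real \<Rightarrow> real) \<Rightarrow> bool" where
  "is_solution N a f lam u \<longleftrightarrow>
     (\<exists>u' u''. C2_unit_interval u u' u'' \<and>
        (\<forall>r\<in>{0<..<1}. u r \<le> 0 \<and>
           ((\<lambda>t. u' t ^ N) has_real_derivative
              lam ^ N * real N * r ^ (N - 1) * a r * f (- u r)) (at r)) \<and>
        u' 0 = 0 \<and> u 1 = 0)"

text \<open>
  Under the hypotheses on \<open>a\<close> and \<open>f\<close>, a nontrivial convex solution is automatically negative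
  and strictly convex in \<open>(0,1)\<close>; the formally weaker requirement is the one used here.
\<close>

definition is_convex_solution ::
  "nat \<Rightarrow> (real \<Rightarrow> real) \<Rightarrow> (real \<Rightarrow> real) \<Rightarrow> real \<Rightarrow> (real \<Rightarrow> real) \<Rightarrow> bool" where
  "is_convex_solution N a f lam u \<longleftrightarrow>
     is_solution N a f lam u \<and> convex_on {0..1} u \<and> (\<exists>r\<in>{0..1}. u r \<noteq> 0)"

end

theory Submission
  imports Defs
begin

text \<open>
  Let \<open>M = max (-u)\<close>, attained at \<open>r\<^sub>0\<close>, let \<open>A\<close> bound \<open>a\<close>, and put \<open>K = \<lambda>\<^sup>N N A \<rho> M\<^sup>N\<close>.
  Since \<open>f(s) \<le> \<rho> s\<^sup>N\<close>, the equation gives \<open>((u')\<^sup>N)' \<le> K\<close>, hence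
  \<open>(u')\<^sup>N \<le> K\<close> on \<open>(0,1)\<close>.  As \<open>u(1) = 0\<close>, the mean value theorem on \<open>[r\<^sub>0,1]\<close> yields
  \<open>M\<^sup>N \<le> K\<close>, that is \<open>M = 0\<close> or \<open>\<lambda>\<^sup>N N A \<rho> \<ge> 1\<close>.
\<close>

text \<open>Passes to the limit at the left end, as \<open>{0..b}\<close> is the closure of
  \<open>{0<..<b}\<close>. It supplies the two inequalities at 0, for \<open>f\<close> and for
  \<open>u\<close>, that are given only to the right of it.\<close>

lemma continuous_le_at_left_end:
  fixes g h :: "real \<Rightarrow> real"
  assumes "continuous_on {0..b} g" "continuous_on {0..b} h" "0 < b"
    and "\<And>x. x \<in> {0<..<b} \<Longrightarrow> g x \<le> h x"
  shows "g 0 \<le> h 0"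
proof -
  have cl: "closure {0<..<b} = {0..b}"
    using assms(3) by (simp add: closure_greaterThanLessThan)
  have "g 0 - h 0 \<le> 0"
    by (rule continuous_le_on_closure[where S = "{0<..<b}" and f = "\<lambda>x. g x - h x"])
      (use assms in \<open>auto simp: cl intro!: continuous_intros\<close>)
  then show ?thesis by simp
qed

lemma mvt_real_derivative:
  fixes g g' :: "real \<Rightarrow> real"
  assumes "a < b" "continuous_on {a..b} g"
    and "\<And>x. a < x \<Longrightarrow> x < b \<Longrightarrow> (g has_real_derivative g' x) (at x)"
  obtains z where "a < z" "z < b" "g b - g a = g' z * (b - a)"
  using mvt[OF assms(1,2), of "\<lambda>x. (*) (g' x)"] assms(3)
  by (auto simp: has_field_derivative_def)

text \<open>For \<open>s > 0\<close> the quotient bound is multiplied out. At \<open>s = 0\<close>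
  it says nothing, and continuity of \<open>f\<close> carries the inequality over.\<close>

lemma power_growth_at_0:
  fixes f :: "real \<Rightarrow> real"
  assumes cont: "continuous_on {0..} f" and bound: "\<And>s. s > 0 \<Longrightarrow> \<bar>f s / s ^ N\<bar> \<le> \<rho>"
    and "s \<ge> 0"
  shows "f s \<le> \<rho> * s ^ N"
proof -
  have pos: "f s \<le> \<rho> * s ^ N" if "s > 0" for s
  proof -
    have "f s / s ^ N \<le> \<rho>"
      using bound[OF that] by linarith
    then show ?thesis
      using that by (simp add: pos_divide_le_eq)
  qed
  have "f 0 \<le> \<rho> * 0 ^ N"
    by (rule continuous_le_at_left_end[where b = 1])
      (use pos cont in \<open>auto intro!: continuous_intros intro: continuous_on_subset\<close>)
  with pos \<open>s \<ge> 0\<close> show ?thesis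
    by (cases "s = 0") auto
qed

text \<open>The bound on \<open>f\<close> has the same degree \<open>N\<close> as the left side of
  the equation, so \<open>M ^ N\<close> cancels at the end and the estimate on \<open>lam\<close>
  does not depend on \<open>u\<close>.\<close>

lemma nontrivial_solution_lower_bound:
  fixes a f u :: "real \<Rightarrow> real"
  assumes N: "N \<ge> 1" and "lam > 0" "A \<ge> 0" "\<rho> \<ge> 0"
    and a: "\<And>r. r \<in> {0..1} \<Longrightarrow> 0 \<le> a r" "\<And>r. r \<in> {0..1} \<Longrightarrow> a r \<le> A"
    and f: "\<And>s. s \<ge> 0 \<Longrightarrow> 0 \<le> f s" "\<And>s. s \<ge> 0 \<Longrightarrow> f s \<le> \<rho> * s ^ N"
    and sol: "is_solution N a f lam u" and nontriv: "\<exists>r\<in>{0..1}. u r \<noteq> 0"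
  shows "1 \<le> lam ^ N * (real N * A * \<rho>)"
proof -
  obtain u' u'' where C2: "C2_unit_interval u u' u''"
    and neg: "\<And>r. r \<in> {0<..<1} \<Longrightarrow> u r \<le> 0"
    and ode: "\<And>r. r \<in> {0<..<1} \<Longrightarrow> ((\<lambda>t. u' t ^ N) has_real_derivative
              lam ^ N * real N * r ^ (N - 1) * a r * f (- u r)) (at r)"
    and bc: "u' 0 = 0" "u 1 = 0"
    using sol unfolding is_solution_def by blast
  have du: "(u has_real_derivative u' r) (at r within {0..1})"
    and du': "(u' has_real_derivative u'' r) (at r within {0..1})" if "r \<in> {0..1}" for r
    using C2 that unfolding C2_unit_interval_def by auto
  have cu: "continuous_on {0..1} u" and cu': "continuous_on {0..1} u'"
    by (rule DERIV_continuous_on, erule du, rule DERIV_continuous_on, erule du')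
  \<comment> \<open>The sign of \<open>u\<close> is known only in the open interval, but the minimum
    point \<open>r0\<close> may be 0.\<close>
  have "u 0 \<le> 0"
    by (rule continuous_le_at_left_end[where b = 1]) (use neg cu in auto)
  then have u_le: "u r \<le> 0" if "r \<in> {0..1}" for r
    using that neg[of r] bc by (cases "r = 0 \<or> r = 1") auto
  obtain r0 where r0: "r0 \<in> {0..1}" "\<And>r. r \<in> {0..1} \<Longrightarrow> u r0 \<le> u r"
    using continuous_attains_inf[of "{0..1::real}" u] cu by auto
  define M where "M = - u r0"
  have "M > 0"
  proof -
    obtain r where "r \<in> {0..1}" "u r \<noteq> 0" using nontriv by blast
    then show ?thesis using u_le[of r] r0(2)[of r] by (simp add: M_def)
  qed
  then have "r0 < 1" using r0(1) bc by (cases "r0 = 1") (auto simp: M_def)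
  define K where "K = lam ^ N * (real N * A * \<rho>) * M ^ N"
  have "K \<ge> 0" using \<open>M > 0\<close> assms(2-4) by (simp add: K_def)
  have rhs_le: "lam ^ N * real N * r ^ (N - 1) * a r * f (- u r) \<le> K" if r: "r \<in> {0<..<1}" for r
  proof -
    have ur: "0 \<le> - u r" "- u r \<le> M"
      using neg[OF r] r0(2)[of r] r by (auto simp: M_def)
    \<comment> \<open>As \<open>f\<close> need not be monotone, it is first replaced by its
      increasing majorant, which is then evaluated at \<open>M\<close>.\<close>
    have "f (- u r) \<le> \<rho> * (- u r) ^ N" using f(2) ur by simp
    also have "\<dots> \<le> \<rho> * M ^ N"
      using ur \<open>\<rho> \<ge> 0\<close> by (intro mult_left_mono power_mono) auto
    finally have fM: "f (- u r) \<le> \<rho> * M ^ N" .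
    have "r ^ (N - 1) \<le> 1" using r by (intro power_le_one) auto
    then have "r ^ (N - 1) * a r * f (- u r) \<le> 1 * A * (\<rho> * M ^ N)"
      using r a[of r] f(1)[OF ur(1)] fM \<open>A \<ge> 0\<close> by (intro mult_mono) auto
    then have "(lam ^ N * real N) * (r ^ (N - 1) * a r * f (- u r))
        \<le> (lam ^ N * real N) * (1 * A * (\<rho> * M ^ N))"
      using \<open>lam > 0\<close> by (intro mult_left_mono) auto
    then show ?thesis by (simp add: K_def mult_ac)
  qed
  have u'_le: "u' \<xi> ^ N \<le> K" if \<xi>: "\<xi> \<in> {0<..<1}" for \<xi>
  proof -
    \<comment> \<open>The equation is integrated from 0, where \<open>u' 0 ^ N\<close> vanishes
      because \<open>N \<ge> 1\<close>.\<close>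
    have "continuous_on {0..\<xi>} (\<lambda>t. u' t ^ N)"
      by (intro continuous_on_power continuous_on_subset[OF cu']) (use \<xi> in auto)
    then obtain z where z: "0 < z" "z < \<xi>" and
      eq: "u' \<xi> ^ N - u' 0 ^ N
        = (lam ^ N * real N * z ^ (N - 1) * a z * f (- u z)) * (\<xi> - 0)"
      by (rule mvt_real_derivative[rotated]) (use ode \<xi> in auto)
    have "\<xi> * (lam ^ N * real N * z ^ (N - 1) * a z * f (- u z)) \<le> \<xi> * K"
      using rhs_le[of z] z \<xi> by (intro mult_left_mono) auto
    also have "\<dots> \<le> K" using \<xi> \<open>K \<ge> 0\<close> by (simp add: mult_left_le_one_le)
    finally show ?thesis using eq bc N by (simp add: power_0_left mult_ac)
  qed
  have "continuous_on {r0..1} u" by (rule continuous_on_subset[OF cu]) (use r0 in auto)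
  moreover have "(u has_real_derivative u' r) (at r)" if "r0 < r" "r < 1" for r
    using du[of r] that r0(1) at_within_Icc_at[of 0 r 1] by simp
  ultimately obtain \<xi> where \<xi>: "r0 < \<xi>" "\<xi> < 1" and eq: "u 1 - u r0 = u' \<xi> * (1 - r0)"
    using mvt_real_derivative[OF \<open>r0 < 1\<close>] by metis
  have M_eq: "M = (1 - r0) * u' \<xi>" using eq bc by (simp add: M_def mult.commute)
  \<comment> \<open>Positivity of the slope allows the factor \<open>1 - r0\<close>, which is at
    most 1, to be dropped.\<close>
  then have "u' \<xi> > 0" using \<open>M > 0\<close> \<open>r0 < 1\<close> by (simp add: zero_less_mult_iff)
  then have "M \<le> u' \<xi>" using M_eq r0(1) by (simp add: mult_left_le_one_le)
  then have "M ^ N \<le> u' \<xi> ^ N" using \<open>M > 0\<close> by (intro power_mono) auto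
  also have "\<dots> \<le> K" using u'_le[of \<xi>] \<xi> r0(1) by auto
  finally have "1 * M ^ N \<le> lam ^ N * (real N * A * \<rho>) * M ^ N" by (simp add: K_def)
  then show ?thesis using \<open>M > 0\<close> by (simp only: mult_le_cancel_right_pos zero_less_power)
qed

theorem corollary5p2:
  fixes N :: nat and a f :: "real \<Rightarrow> real"
  assumes "N \<ge> 1"
    and "continuous_on {0..1} a"
    and "\<And>r. r \<in> {0..1} \<Longrightarrow> a r \<ge> 0"
    and "\<And>c d. 0 \<le> c \<Longrightarrow> c < d \<Longrightarrow> d \<le> 1 \<Longrightarrow> \<exists>r\<in>{c..d}. a r \<noteq> 0"
    and "continuous_on {0..} f"
    and "\<And>s. s \<ge> 0 \<Longrightarrow> f s \<ge> 0"
    and "\<And>s. s > 0 \<Longrightarrow> f s > 0"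
    and "\<exists>\<rho>>0. \<forall>s>0. \<bar>f s / s ^ N\<bar> \<le> \<rho>"
  shows "\<exists>\<eta>>0. \<forall>lam\<in>{0<..<\<eta>}. \<nexists>u. is_convex_solution N a f lam u"
proof -
  obtain \<rho> where \<rho>: "\<rho> > 0" "\<And>s. s > 0 \<Longrightarrow> \<bar>f s / s ^ N\<bar> \<le> \<rho>"
    using assms(8) by blast
  obtain r1 where r1: "r1 \<in> {0..1}" "\<And>r. r \<in> {0..1} \<Longrightarrow> a r \<le> a r1"
    using continuous_attains_sup[of "{0..1::real}" a] assms(2) by auto
  define C where "C = real N * a r1 * \<rho>"
  have "C \<ge> 0" using assms(3)[OF r1(1)] \<rho>(1) by (simp add: C_def)
  show ?thesis
  \<comment> \<open>Below this threshold \<open>lam * C + lam < 1\<close>, which gives both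
    \<open>lam < 1\<close> and \<open>lam * C < 1\<close>. The former yields
    \<open>lam ^ N \<le> lam\<close>, so no \<open>N\<close>-th root of \<open>C\<close> has to be
    taken.\<close>
  proof (intro exI[of _ "1 / (C + 1)"] conjI ballI notI)
    show "1 / (C + 1) > 0" using \<open>C \<ge> 0\<close> by simp
  next
    fix lam
    assume lam: "lam \<in> {0<..<1 / (C + 1)}" and "\<exists>u. is_convex_solution N a f lam u"
    then obtain u where u: "is_solution N a f lam u" "\<exists>r\<in>{0..1}. u r \<noteq> 0"
      by (auto simp: is_convex_solution_def)
    have bound: "1 \<le> lam ^ N * C"
      unfolding C_def
      by (rule nontrivial_solution_lower_bound[OF assms(1) _ _ _ assms(3) r1(2) assms(6) _ u])
        (use lam \<rho> r1(1) assms(3) power_growth_at_0[OF assms(5) \<rho>(2)] in auto)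
    have small: "lam * (C + 1) < 1" "0 < lam"
      using lam \<open>C \<ge> 0\<close> by (auto simp: pos_less_divide_eq)
    then have "lam \<le> 1"
      using \<open>C \<ge> 0\<close> mult_nonneg_nonneg[of lam C] unfolding distrib_left by linarith
    then have "lam ^ N \<le> lam"
      using small(2) assms(1) power_decreasing[of 1 N lam] by simp
    then have "lam ^ N * C \<le> lam * C" using \<open>C \<ge> 0\<close> by (rule mult_right_mono)
    with bound small show False by (simp add: algebra_simps)
  qed
qed

end
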